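(* For all positive integers $n, m, k$ with $1 \leq m \leq n-1$ and $1 \leq k \leq n-1$, we have $$p^{UU}_{n,m,k}=p^{DD}_{n,m,k}=\frac{1}{n-1}\binom{n-1}{k}\binom{n-1}{k-1}.$$
   Context: Let $\mathcal{L}_n$ be the set of lattice paths in $\mathbb{Z}\times\mathbb{Z}$ from $(0,0)$ to $(n,n)$ using up steps $U=(0,1)$ and down steps $D=(1,0)$. A path is identified with a word of length $2n$ in the letters $U, D$ (with $n$ of each). An up step lies below the line $y=x$ if it goes from $(a,b)$ to $(a,b+1)$ with $b<a$. An $(n,m)$-Dyck path is a path in $\mathcal{L}_n$ with exactly $m$ up steps below the line $y=x$. A peak of a path is an occurrence of two consecutive steps $UD$. $\mathcal{P}_{n,m,k}$ denotes the set of all $(n,m)$-Dyck paths with exactly $k$ peaks. For $A,B\in\{U,D\}$, $\mathcal{P}^{AB}_{n,m,k}$ denotes the set of paths in $\mathcal{P}_{n,m,k}$ whose first step is $A$ and whose last step is $B$, and $p^{AB}_{n,m,k}=|\mathcal{P}^{AB}_{n,m,k}|$. *)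

theory Defs
  imports Complex_Main "HOL-Library.Product_Plus"
begin

datatype step = U | D

fun step_vec :: "step \<Rightarrow> int \<times> int" where
  "step_vec U = (0, 1)"
| "step_vec D = (1, 0)"

(* The lattice point reached from the origin after the first i steps of w. *)
definition vertex :: "step list \<Rightarrow> nat \<Rightarrow> int \<times> int" where
  "vertex w i = (\<Sum>s\<leftarrow>take i w. step_vec s)"

definition lattice_paths :: "nat \<Rightarrow> step list set" where
  "lattice_paths n = {w. vertex w (length w) = (int n, int n)}"

definition up_steps_below :: "step list \<Rightarrow> nat set" where
  "up_steps_below w =
     {i. i < length w \<and> w ! i = U \<and> (\<exists>a b. vertex w i = (a, b) \<and> b < a)}"

definition peaks :: "step list \<Rightarrow> nat set" where
  "peaks w = {i. Suc i < length w \<and> w ! i = U \<and> w ! Suc i = D}"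

definition dyck_paths :: "nat \<Rightarrow> nat \<Rightarrow> step list set" where
  "dyck_paths n m = {w \<in> lattice_paths n. card (up_steps_below w) = m}"

definition dyck_paths_peaks :: "nat \<Rightarrow> nat \<Rightarrow> nat \<Rightarrow> step list set" where
  "dyck_paths_peaks n m k = {w \<in> dyck_paths n m. card (peaks w) = k}"

definition dyck_paths_ends ::
    "step \<Rightarrow> step \<Rightarrow> nat \<Rightarrow> nat \<Rightarrow> nat \<Rightarrow> step list set" where
  "dyck_paths_ends A B n m k =
     {w \<in> dyck_paths_peaks n m k. w \<noteq> [] \<and> hd w = A \<and> last w = B}"

definition num_dyck_paths_ends ::
    "step \<Rightarrow> step \<Rightarrow> nat \<Rightarrow> nat \<Rightarrow> nat \<Rightarrow> nat" where
  "num_dyck_paths_ends A B n m k = card (dyck_paths_ends A B n m k)"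

lemma vertex_length:
  "vertex w (length w) = (int (count_list w D), int (count_list w U))"
proof -
  have "(\<Sum>s\<leftarrow>w. step_vec s) = (int (count_list w D), int (count_list w U))"
  proof (induction w)
    case Nil
    show ?case by (simp add: zero_prod_def)
  next
    case (Cons s w)
    then show ?case by (cases s) auto
  qed
  then show ?thesis by (simp add: vertex_def)
qed

lemma lattice_paths_iff:
  "w \<in> lattice_paths n \<longleftrightarrow> count_list w U = n \<and> count_list w D = n"
  by (auto simp: lattice_paths_def vertex_length)

lemma length_eq_count_steps: "length w = count_list w U + count_list w D"
proof (induction w)
  case (Cons s w)
  then show ?case by (cases s) auto
qed simp

lemma length_lattice_path: "w \<in> lattice_paths n \<Longrightarrow> length w = 2 * n"
  by (simp add: lattice_paths_iff length_eq_count_steps)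

lemma finite_lattice_paths: "finite (lattice_paths n)"
proof (rule finite_subset)
  have "UNIV = {U, D}" using step.exhaust by auto
  then have "finite (UNIV :: step set)" by (metis finite.emptyI finite.insertI)
  then show "finite {w :: step list. set w \<subseteq> UNIV \<and> length w = 2 * n}"
    by (rule finite_lists_length_eq)
qed (auto simp: length_lattice_path)

end

theory Submission
  imports Defs
begin

text \<open>
  A path that starts and ends with \<open>U\<close> is a word \<open>U D^c\<^sub>1 U D^c\<^sub>2 \<dots> U D^c\<^sub>N U\<close> with
  \<open>N = n - 1\<close> exponents of sum \<open>n = N + 1\<close>. Its peaks correspond to the nonzero exponents, and
  its up steps below the diagonal to the positive partial sums of the sequence \<open>c\<^sub>i - 1\<close>, whose
  total is \<open>1\<close> (\<open>dyck_paths_ends_UU\<close>). Rotating \<open>c\<close> keeps the number of peaks. By a form of the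
  cycle lemma (\<open>card_positive_partial_sums_bij\<close>), the \<open>N\<close> rotations of an integer sequence of
  total \<open>1\<close> have \<open>1, \<dots>, N\<close> positive partial sums, each value occurring once. So all values
  \<open>m = 1, \<dots>, N\<close> are taken by equally many paths, say \<open>p\<close>, and \<open>N p = C(N, k) C(n - 1, k - 1)\<close>,
  because the right-hand side counts all exponent sequences with \<open>k\<close> nonzero entries: choose
  their positions, then a composition of \<open>n\<close> into \<open>k\<close> parts (\<open>card_sparse_lists\<close>).

  Paths that start and end with \<open>D\<close> reduce to this case by reflection in the antidiagonal
  (\<open>num_dyck_paths_ends_flip\<close>), which reverses the word and exchanges the letters. It keeps peaks
  and the side of the diagonal but turns up steps into down steps; a path from the diagonal to
  itself has equally many of both below the diagonal.
\<close>

section \<open>Statistics of a path, step by step\<close>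

lemma card_less_Suc_Collect:
  "card {i. i < Suc n \<and> P i} = of_bool (P 0) + card {i. i < n \<and> P (Suc i)}"
proof -
  have "{i. i < Suc n \<and> P i} = (if P 0 then {0} else {}) \<union> Suc ` {i. i < n \<and> P (Suc i)}"
    by (auto simp: image_iff less_Suc_eq_0_disj)
  then show ?thesis
    by (simp add: card_image card_insert_if image_iff)
qed

text \<open>
  The argument \<open>h\<close> is the current value of \<open>x - y\<close>, so that the count for a path can be
  computed from any of its suffixes.
\<close>

fun ups_below_from :: "int \<Rightarrow> step list \<Rightarrow> nat" where
  "ups_below_from h [] = 0"
| "ups_below_from h (U # w) = of_bool (h > 0) + ups_below_from (h - 1) w"
| "ups_below_from h (D # w) = ups_below_from (h + 1) w"

lemma card_ups_below_from:
  "card {i. i < length w \<and> w ! i = U \<and> snd (vertex w i) < fst (vertex w i) + h}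
    = ups_below_from h w"
proof (induction w arbitrary: h)
  case (Cons s w)
  have vtx: "vertex (t # w) (Suc i) = step_vec t + vertex w i" for t i
    by (simp add: vertex_def)
  show ?case
  proof (cases s)
    case U
    show ?thesis
      using Cons.IH[of "h - 1"] U
      by (simp add: card_less_Suc_Collect vtx algebra_simps) (simp add: vertex_def zero_prod_def)
  next
    case D
    show ?thesis
      using Cons.IH[of "h + 1"] D
      by (simp add: card_less_Suc_Collect vtx algebra_simps)
  qed
qed simp

lemma card_up_steps_below: "card (up_steps_below w) = ups_below_from 0 w"
proof -
  have "up_steps_below w
      = {i. i < length w \<and> w ! i = U \<and> snd (vertex w i) < fst (vertex w i) + 0}"
    by (auto simp: up_steps_below_def) (metis prod.collapse)
  then show ?thesis
    by (simp only: card_ups_below_from)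
qed

lemma card_peaks_Nil: "card (peaks []) = 0"
  by (simp add: peaks_def)

lemma card_peaks_Cons:
  "card (peaks (s # w)) = of_bool (s = U \<and> w \<noteq> [] \<and> hd w = D) + card (peaks w)"
proof (cases w)
  case Nil
  then show ?thesis by (simp add: peaks_def)
next
  case (Cons t v)
  have "card (peaks (s # w))
      = card {i. i < Suc (length v) \<and> (s # w) ! i = U \<and> (s # w) ! Suc i = D}"
    using Cons by (simp add: peaks_def)
  also have "\<dots> = of_bool (s = U \<and> t = D)
      + card {i. i < length v \<and> w ! i = U \<and> w ! Suc i = D}"
    using Cons by (simp add: card_less_Suc_Collect)
  finally show ?thesis
    using Cons by (simp add: peaks_def)
qed

section \<open>Reflection in the antidiagonal\<close>

fun flip :: "step \<Rightarrow> step" where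
  "flip U = D"
| "flip D = U"

lemma flip_flip [simp]: "flip (flip s) = s"
  by (cases s) auto

lemma flip_eq_iff [simp]: "flip s = U \<longleftrightarrow> s = D" "flip s = D \<longleftrightarrow> s = U"
  by (cases s; simp)+

definition antireflect :: "step list \<Rightarrow> step list" where
  "antireflect w = rev (map flip w)"

lemma antireflect_simps [simp]:
  "antireflect [] = []"
  "antireflect (s # w) = antireflect w @ [flip s]"
  "antireflect w = [] \<longleftrightarrow> w = []"
  by (simp_all add: antireflect_def)

lemma antireflect_antireflect [simp]: "antireflect (antireflect w) = w"
  by (simp add: antireflect_def rev_map comp_def)

lemma hd_antireflect: "w \<noteq> [] \<Longrightarrow> hd (antireflect w) = flip (last w)"
  by (simp add: antireflect_def hd_rev last_map)

lemma last_antireflect: "w \<noteq> [] \<Longrightarrow> last (antireflect w) = flip (hd w)"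
  by (simp add: antireflect_def last_rev hd_map)

lemma count_list_antireflect: "count_list (antireflect w) s = count_list w (flip s)"
proof (induction w)
  case (Cons t w)
  then show ?case by (cases s; cases t) auto
qed simp

lemma card_peaks_snoc:
  "card (peaks (w @ [s])) = card (peaks w) + of_bool (w \<noteq> [] \<and> last w = U \<and> s = D)"
  by (induction w) (auto simp: card_peaks_Cons card_peaks_Nil hd_append)

lemma card_peaks_antireflect: "card (peaks (antireflect w)) = card (peaks w)"
  by (induction w) (auto simp: card_peaks_Cons card_peaks_snoc last_antireflect)

lemma ups_below_from_snoc:
  "ups_below_from h (w @ [s]) = ups_below_from h w
    + of_bool (s = U \<and> h + int (count_list w D) - int (count_list w U) > 0)"
  by (induction h w rule: ups_below_from.induct) (cases s; simp add: algebra_simps)+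

text \<open>
  On a path that starts at \<open>x - y = h\<close> and ends on the diagonal, the left-hand side counts the
  up steps below the diagonal, and \<open>ups_below_from 0 (antireflect w)\<close> counts the down steps on
  that side. The former decrease \<open>max 0 (x - y)\<close> by one, the latter increase it by one, and all
  other steps keep it, so the two numbers differ by its initial value.
\<close>

lemma ups_below_from_antireflect:
  assumes "h = int (count_list w U) - int (count_list w D)"
  shows "int (ups_below_from h w) = int (ups_below_from 0 (antireflect w)) + max 0 h"
  using assms
proof (induction w arbitrary: h)
  case (Cons s w)
  show ?case
  proof (cases s)
    case U
    then show ?thesis
      using Cons.IH[of "h - 1"] Cons.prems
      by (auto simp: ups_below_from_snoc)
  next
    case D
    then show ?thesis
      using Cons.IH[of "h + 1"] Cons.prems
      by (auto simp: ups_below_from_snoc count_list_antireflect)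
  qed
qed simp

lemma antireflect_dyck_paths_ends:
  assumes "w \<in> dyck_paths_ends A B n m k"
  shows "antireflect w \<in> dyck_paths_ends (flip B) (flip A) n m k"
proof -
  have "ups_below_from 0 (antireflect w) = ups_below_from 0 w"
    using assms ups_below_from_antireflect[of 0 w]
    by (simp add: dyck_paths_ends_def dyck_paths_peaks_def dyck_paths_def lattice_paths_iff)
  then show ?thesis
    using assms
    by (simp add: dyck_paths_ends_def dyck_paths_peaks_def dyck_paths_def lattice_paths_iff
        card_up_steps_below card_peaks_antireflect count_list_antireflect
        hd_antireflect last_antireflect)
qed

lemma num_dyck_paths_ends_flip:
  "num_dyck_paths_ends (flip B) (flip A) n m k = num_dyck_paths_ends A B n m k"
proof -
  have "bij_betw antireflect (dyck_paths_ends A B n m k)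
      (dyck_paths_ends (flip B) (flip A) n m k)"
    using antireflect_dyck_paths_ends[of _ A B] antireflect_dyck_paths_ends[of _ "flip B" "flip A"]
    by (intro bij_betw_byWitness[where f' = antireflect]) auto
  then show ?thesis
    by (simp add: num_dyck_paths_ends_def bij_betw_same_card)
qed

section \<open>Paths from up step to up step as sequences of exponents\<close>

fun up_path :: "nat list \<Rightarrow> step list" where
  "up_path [] = [U]"
| "up_path (c # cs) = U # replicate c D @ up_path cs"

lemma up_path_nonempty [simp]: "up_path cs \<noteq> []"
  by (cases cs) auto

lemma hd_up_path [simp]: "hd (up_path cs) = U"
  by (cases cs) auto

lemma last_up_path [simp]: "last (up_path cs) = U"
  by (induction cs) auto

text \<open>
  Suffixes of an encoded word may begin with down steps; the leading block \<open>replicate c D\<close>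
  makes the statement hold for them too, so that it can be proved letter by letter.
\<close>

lemma ex_up_path: "w \<noteq> [] \<Longrightarrow> last w = U \<Longrightarrow> \<exists>c cs. w = replicate c D @ up_path cs"
proof (induction w)
  case (Cons s w)
  show ?case
  proof (cases "w = []")
    case True
    with Cons.prems have "s # w = replicate 0 D @ up_path []" by simp
    then show ?thesis by blast
  next
    case False
    with Cons obtain c cs where w: "w = replicate c D @ up_path cs" by auto
    show ?thesis
    proof (cases s)
      case U
      with w have "s # w = replicate 0 D @ up_path (c # cs)" by simp
      then show ?thesis by blast
    next
      case D
      with w have "s # w = replicate (Suc c) D @ up_path cs" by simp
      then show ?thesis by blast
    qed
  qed
qed simp

lemma length_takeWhile_D_up_path:
  "length (takeWhile (\<lambda>s. s = D) (replicate c D @ up_path cs)) = c"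
proof -
  have "takeWhile (\<lambda>s. s = D) (up_path cs) = []" by (cases cs) simp_all
  then show ?thesis by (induction c) simp_all
qed

lemma replicate_up_path_inject:
  assumes "replicate c D @ up_path cs = replicate c' D @ up_path cs'"
  shows "c = c' \<and> cs = cs'"
proof -
  have first: "c = c'" if "replicate c D @ up_path cs = replicate c' D @ up_path cs'" for c c' cs cs'
    using arg_cong[OF that, of "\<lambda>w. length (takeWhile (\<lambda>s. s = D) w)"]
    by (simp only: length_takeWhile_D_up_path)
  have "up_path cs = up_path cs' \<Longrightarrow> cs = cs'" for cs cs'
  proof (induction cs arbitrary: cs')
    case Nil
    then show ?case by (cases cs') auto
  next
    case (Cons d ds)
    from Cons.prems obtain d' ds' where cs': "cs' = d' # ds'"
      by (cases cs') auto
    with Cons.prems have eq: "replicate d D @ up_path ds = replicate d' D @ up_path ds'"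
      by simp
    then have "d = d'" by (rule first)
    moreover from this eq have "up_path ds = up_path ds'" by simp
    then have "ds = ds'" by (rule Cons.IH)
    ultimately show ?case using cs' by simp
  qed
  moreover have "c = c'" using assms by (rule first)
  ultimately show ?thesis using assms by simp
qed

lemma inj_up_path: "inj up_path"
  using replicate_up_path_inject[of 0 _ 0] by (auto intro: injI)

lemma ex_up_path_iff: "(\<exists>cs. w = up_path cs) \<longleftrightarrow> w \<noteq> [] \<and> hd w = U \<and> last w = U"
proof
  assume w: "w \<noteq> [] \<and> hd w = U \<and> last w = U"
  then obtain c cs where "w = replicate c D @ up_path cs" using ex_up_path by blast
  moreover from this w have "c = 0" by (cases c) auto
  ultimately show "\<exists>cs. w = up_path cs" by auto
qed auto

lemma count_list_replicate: "count_list (replicate c a) b = (if a = b then c else 0)"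
  by (induction c) auto

lemma count_list_up_path:
  "count_list (up_path cs) U = Suc (length cs)" "count_list (up_path cs) D = sum_list cs"
  by (induction cs) (simp_all add: count_list_replicate)

lemma card_peaks_replicate_D: "card (peaks (replicate c D @ w)) = card (peaks w)"
  by (induction c) (simp_all add: card_peaks_Cons)

lemma card_peaks_up_path: "card (peaks (up_path cs)) = length (filter (\<lambda>c. c \<noteq> 0) cs)"
proof (induction cs)
  case (Cons c cs)
  then show ?case
    by (cases c) (simp_all add: card_peaks_Cons card_peaks_replicate_D)
qed (simp add: card_peaks_Cons card_peaks_Nil)

text \<open>
  The partial sums are those of the entries minus one; moving the ones to the other side of the
  inequality avoids truncated subtraction.
\<close>

definition positive_partial_sums :: "nat list \<Rightarrow> nat" where
  "positive_partial_sums cs = card {j. j < length cs \<and> Suc j < sum_list (take (Suc j) cs)}"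

lemma ups_below_from_replicate_D: "ups_below_from h (replicate c D @ w) = ups_below_from (h + int c) w"
  by (induction c arbitrary: h) (simp_all add: algebra_simps)

text \<open>
  Up step number \<open>j\<close>, counted from \<open>0\<close>, starts at height \<open>j\<close> after as many down steps as the
  first \<open>j\<close> exponents add up to. There is one more up step than there are exponents.
\<close>

lemma ups_below_from_up_path:
  "ups_below_from h (up_path cs)
    = card {j. j < Suc (length cs) \<and> int j < h + int (sum_list (take j cs))}"
proof (induction cs arbitrary: h)
  case Nil
  then show ?case using card_less_Suc_Collect[of 0 "\<lambda>j. int j < h"] by simp
next
  case (Cons c cs)
  have "ups_below_from h (up_path (c # cs)) = of_bool (h > 0)
      + card {j. j < Suc (length cs) \<and> int j < h - 1 + int c + int (sum_list (take j cs))}"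
    using Cons.IH[of "h - 1 + int c"] by (simp add: ups_below_from_replicate_D)
  also have "\<dots> = card {j. j < Suc (Suc (length cs))
      \<and> int j < h + int (sum_list (take j (c # cs)))}"
    by (subst card_less_Suc_Collect[of "Suc (length cs)"]) (simp add: algebra_simps)
  finally show ?case by simp
qed

lemma card_up_steps_below_up_path:
  "card (up_steps_below (up_path cs)) = positive_partial_sums cs"
proof -
  have "card (up_steps_below (up_path cs))
      = card {j. j < length cs \<and> int (Suc j) < int (sum_list (take (Suc j) cs))}"
    unfolding card_up_steps_below ups_below_from_up_path
    by (subst card_less_Suc_Collect) simp
  then show ?thesis
    by (simp only: positive_partial_sums_def of_nat_less_iff)
qed

definition sparse_lists :: "nat \<Rightarrow> nat \<Rightarrow> nat \<Rightarrow> nat list set" where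
  "sparse_lists N s k
    = {cs. length cs = N \<and> sum_list cs = s \<and> length (filter (\<lambda>c. c \<noteq> 0) cs) = k}"

lemma dyck_paths_ends_UU:
  "dyck_paths_ends U U (Suc N) m k
    = up_path ` {cs \<in> sparse_lists N (Suc N) k. positive_partial_sums cs = m}"
  (is "?L = ?R")
proof (rule set_eqI)
  fix w
  have "w \<in> ?L \<longleftrightarrow> (\<exists>cs. w = up_path cs) \<and> w \<in> dyck_paths_peaks (Suc N) m k"
    by (auto simp: dyck_paths_ends_def ex_up_path_iff)
  also have "\<dots> \<longleftrightarrow> w \<in> ?R"
    by (auto simp: dyck_paths_peaks_def dyck_paths_def lattice_paths_iff count_list_up_path
        card_peaks_up_path card_up_steps_below_up_path sparse_lists_def)
  finally show "w \<in> ?L \<longleftrightarrow> w \<in> ?R" .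
qed

section \<open>The cycle lemma\<close>

lemma rank_bij_betw:
  fixes f :: "'a \<Rightarrow> 'b::linorder"
  assumes fin: "finite A" and inj: "inj_on f A"
  shows "bij_betw (\<lambda>r. card {j \<in> A. f r \<le> f j}) A {1..card A}"
proof -
  let ?g = "\<lambda>r. card {j \<in> A. f r \<le> f j}"
  have less: "?g s < ?g r" if "r \<in> A" "s \<in> A" "f r < f s" for r s
  proof (rule psubset_card_mono)
    have "r \<in> {j \<in> A. f r \<le> f j} - {j \<in> A. f s \<le> f j}" using that by auto
    moreover have "{j \<in> A. f s \<le> f j} \<subseteq> {j \<in> A. f r \<le> f j}" using that by auto
    ultimately show "{j \<in> A. f s \<le> f j} \<subset> {j \<in> A. f r \<le> f j}" by blast
  qed (use fin in simp)
  have inj_g: "inj_on ?g A"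
  proof (rule inj_onI)
    fix r s assume rs: "r \<in> A" "s \<in> A" "?g r = ?g s"
    then have "f r = f s"
      using less[of r s] less[of s r] by (metis less_irrefl linorder_neqE)
    with rs inj show "r = s" by (auto dest: inj_onD)
  qed
  have "?g ` A \<subseteq> {1..card A}"
  proof
    fix x assume "x \<in> ?g ` A"
    then obtain r where r: "r \<in> A" "x = ?g r" by auto
    have "?g r \<le> card A" by (rule card_mono) (use fin in auto)
    moreover have "?g r > 0" using r fin by (auto simp: card_gt_0_iff)
    ultimately show "x \<in> {1..card A}" using r by simp
  qed
  moreover have "card (?g ` A) = card {1..card A}"
    using card_image[OF inj_g] by simp
  ultimately have "?g ` A = {1..card A}"
    by (intro card_subset_eq) auto
  with inj_g show ?thesis by (simp add: bij_betw_def)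
qed

lemma card_window_mod:
  fixes N r :: nat
  assumes "N > 0" and P: "\<And>j. P (j mod N) \<longleftrightarrow> P j"
  shows "card {j. j < N \<and> P (r + Suc j)} = card {j. j < N \<and> P j}"
proof -
  let ?f = "\<lambda>j. (r + Suc j) mod N"
  have inj: "inj_on ?f {..<N}"
  proof (rule linorder_inj_onI)
    fix i j assume "i < j" "i \<in> {..<N}" "j \<in> {..<N}"
    then have "\<not> N dvd (r + Suc j) - (r + Suc i)" by (auto dest: dvd_imp_le)
    with \<open>i < j\<close> show "?f i \<noteq> ?f j"
      using mod_eq_dvd_iff_nat[of "r + Suc i" "r + Suc j" N] by auto
  qed auto
  have "?f ` {..<N} = {..<N}"
    using inj assms(1) by (intro endo_inj_surj) auto
  then have "{j. j < N \<and> P j} = ?f ` {j. j < N \<and> P (r + Suc j)}"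
    using P by (auto simp: image_iff set_eq_iff) (metis lessThan_iff)+
  then show ?thesis
    using inj by (simp add: card_image inj_on_subset subset_eq)
qed

text \<open>
  Continue the sequence periodically, so that its partial sums satisfy \<open>S(j + N) = S(j) + 1\<close>.
  Then \<open>N S(j) - j\<close> has period \<open>N\<close>, and being congruent to \<open>-j\<close> it separates residues modulo
  \<open>N\<close>. For \<open>r < j \<le> r + N\<close>,
  \<open>S(j)\<close> exceeds \<open>S(r)\<close> iff \<open>N S(j) - j\<close> is at least \<open>N S(r) - r\<close>. So the number of positive
  partial sums after rotation by \<open>r\<close> is the rank of \<open>r\<close> in a linear order.
\<close>

lemma card_positive_partial_sums_bij:
  assumes sum: "sum_list cs = Suc (length cs)" and "cs \<noteq> []"
  shows "bij_betw (\<lambda>r. positive_partial_sums (rotate r cs)) {..<length cs} {1..length cs}"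
proof -
  define N where "N = length cs"
  have N: "N > 0" using assms by (simp add: N_def)
  define S where "S j = (\<Sum>i<j. int (cs ! (i mod N)) - 1)" for j
  define T where "T j = int N * S j - int j" for j
  have S_add: "S (r + j) = S r + (\<Sum>i<j. int (cs ! ((r + i) mod N)) - 1)" for r j
    by (induction j) (simp_all add: S_def)
  have S_N: "S N = 1"
  proof -
    have "(\<Sum>i<N. int (cs ! (i mod N))) = int (sum_list cs)"
      by (simp add: N_def sum_list_sum_nth atLeast0LessThan)
    then show ?thesis using sum by (simp add: S_def sum_subtractf N_def)
  qed
  have T_add: "T (j + N) = T j" for j
    using S_add[of N j] S_N
    by (simp add: T_def S_def add.commute algebra_simps)
  have T_mod: "T (j mod N) = T j" for j
  proof -
    have "T (i + q * N) = T i" for i q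
    proof (induction q)
      case (Suc q)
      have "i + Suc q * N = (i + q * N) + N" by simp
      with Suc show ?case by (simp only: T_add)
    qed simp
    then show ?thesis by (metis mod_div_mult_eq)
  qed
  have T_inj: "inj_on T {..<N}"
  proof (rule inj_onI)
    fix i j assume ij: "i \<in> {..<N}" "j \<in> {..<N}" "T i = T j"
    then have "int N * (S i - S j) = int i - int j" by (simp add: T_def algebra_simps)
    then have "int i mod int N = int j mod int N"
      by (metis dvd_triv_left mod_eq_dvd_iff)
    with ij show "i = j" by simp
  qed
  have T_iff: "S r < S (r + Suc j) \<longleftrightarrow> T r \<le> T (r + Suc j)" if "j < N" for r j
  proof -
    let ?d = "S (r + Suc j) - S r"
    have eq: "T (r + Suc j) - T r = int N * ?d - int (Suc j)"
      by (simp add: T_def algebra_simps)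
    show ?thesis
    proof (cases "?d > 0")
      case True
      then have "int N * 1 \<le> int N * ?d" by (intro mult_left_mono) auto
      moreover have "int (Suc j) \<le> int N" using that by simp
      ultimately have "T r \<le> T (r + Suc j)" using eq by linarith
      with True show ?thesis by simp
    next
      case False
      then have "int N * ?d \<le> 0" by (simp add: mult_nonneg_nonpos)
      then have "T (r + Suc j) < T r" using eq by linarith
      with False show ?thesis by simp
    qed
  qed
  have partial_sum: "int (sum_list (take (Suc j) (rotate r cs))) = S (r + Suc j) - S r + int (Suc j)"
    if "j < N" for r j
  proof -
    have "int (sum_list (take (Suc j) (rotate r cs))) = (\<Sum>i<Suc j. int (rotate r cs ! i))"
      using that
      by (simp add: sum_list_sum_nth N_def atLeast0LessThan min_absorb2 del: sum.lessThan_Suc)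
    also have "\<dots> = (\<Sum>i<Suc j. int (cs ! ((r + i) mod N)))"
      using that by (intro sum.cong refl) (simp add: nth_rotate N_def)
    finally show ?thesis by (simp only: S_add[of r "Suc j"] sum_subtractf) simp
  qed
  have "positive_partial_sums (rotate r cs) = card {j \<in> {..<N}. T r \<le> T j}" for r
  proof -
    have "{j. j < N \<and> Suc j < sum_list (take (Suc j) (rotate r cs))}
        = {j. j < N \<and> T r \<le> T (r + Suc j)}"
      using partial_sum[of _ r] T_iff[of _ r] by fastforce
    then show ?thesis
      using card_window_mod[of N "\<lambda>j. T r \<le> T j" r] N T_mod
      by (simp add: positive_partial_sums_def N_def)
  qed
  then show ?thesis
    using rank_bij_betw[OF _ T_inj] by (simp add: N_def)
qed

lemma card_rotations_positive_partial_sums: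
  assumes "sum_list cs = Suc (length cs)" and "1 \<le> m" "m \<le> length cs"
  shows "card {r \<in> {..<length cs}. positive_partial_sums (rotate r cs) = m} = 1"
proof -
  have bij: "bij_betw (\<lambda>r. positive_partial_sums (rotate r cs)) {..<length cs} {1..length cs}"
    using assms by (intro card_positive_partial_sums_bij) auto
  then have "m \<in> (\<lambda>r. positive_partial_sums (rotate r cs)) ` {..<length cs}"
    using assms by (simp add: bij_betw_imp_surj_on)
  then obtain r where "r < length cs" "positive_partial_sums (rotate r cs) = m"
    by auto
  with bij have "{r \<in> {..<length cs}. positive_partial_sums (rotate r cs) = m} = {r}"
    by (auto simp: bij_betw_def dest: inj_onD)
  then show ?thesis by simp
qed

section \<open>Counting exponent sequences\<close>

lemma finite_lists_sum_nat: "finite {cs :: nat list. length cs = N \<and> sum_list cs = s}"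
proof (rule finite_subset)
  show "{cs :: nat list. length cs = N \<and> sum_list cs = s} \<subseteq> {cs. set cs \<subseteq> {..s} \<and> length cs = N}"
    by (auto dest: member_le_sum_list)
qed (simp add: finite_lists_length_eq)

lemma finite_sparse_lists: "finite (sparse_lists N s k)"
  by (rule finite_subset[OF _ finite_lists_sum_nat[of N s]]) (auto simp: sparse_lists_def)

lemma rotate_sparse_lists_bij: "bij_betw (rotate r) (sparse_lists N s k) (sparse_lists N s k)"
proof -
  have rotate1: "rotate1 cs \<in> sparse_lists N s k" if "cs \<in> sparse_lists N s k" for cs
    using that by (cases cs) (auto simp: sparse_lists_def)
  have "rotate r cs \<in> sparse_lists N s k" if "cs \<in> sparse_lists N s k" for cs
    using that rotate1 by (induction r) simp_all
  then have maps: "rotate r ` sparse_lists N s k \<subseteq> sparse_lists N s k"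
    by blast
  have "inj (rotate r :: nat list \<Rightarrow> _)"
    unfolding rotate_def by (rule inj_fn) (rule inj_rotate1)
  then have inj: "inj_on (rotate r) (sparse_lists N s k)" by (rule inj_on_subset) simp
  then show ?thesis
    using endo_inj_surj[OF finite_sparse_lists maps inj] by (simp add: bij_betw_def)
qed

text \<open>
  Double counting of the pairs \<open>(cs, r)\<close> whose rotation has the prescribed number of positive
  partial sums: each \<open>cs\<close> has one such \<open>r\<close>, and each \<open>r\<close> permutes the sequences.
\<close>

lemma card_sparse_lists_equidistributed:
  assumes m: "1 \<le> m" "m \<le> N"
  shows "N * card {cs \<in> sparse_lists N (Suc N) k. positive_partial_sums cs = m}
    = card (sparse_lists N (Suc N) k)"
proof -
  let ?L = "sparse_lists N (Suc N) k"
  have "card ?L = (\<Sum>cs\<in>?L. card {r \<in> {..<N}. positive_partial_sums (rotate r cs) = m})"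
  proof -
    have "card {r \<in> {..<N}. positive_partial_sums (rotate r cs) = m} = 1" if "cs \<in> ?L" for cs
      using card_rotations_positive_partial_sums[of cs m] m that by (simp add: sparse_lists_def)
    then show ?thesis by simp
  qed
  also have "\<dots> = (\<Sum>r<N. card {cs \<in> ?L. positive_partial_sums (rotate r cs) = m})"
    by (rule sum_multicount_gen[symmetric]) (auto simp: finite_sparse_lists)
  also have "\<dots> = (\<Sum>r<N. card {cs \<in> ?L. positive_partial_sums cs = m})"
  proof (rule sum.cong)
    fix r
    have bij: "bij_betw (rotate r) ?L ?L" by (rule rotate_sparse_lists_bij)
    have image: "rotate r ` {cs \<in> ?L. positive_partial_sums (rotate r cs) = m}
        = {cs \<in> ?L. positive_partial_sums cs = m}"
      using bij by (auto simp: bij_betw_def)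
    have "inj_on (rotate r) {cs \<in> ?L. positive_partial_sums (rotate r cs) = m}"
      by (rule inj_on_subset[OF bij_betw_imp_inj_on[OF bij]]) blast
    from card_image[OF this] show "card {cs \<in> ?L. positive_partial_sums (rotate r cs) = m}
        = card {cs \<in> ?L. positive_partial_sums cs = m}"
      by (simp only: image)
  qed simp
  finally show ?thesis by simp
qed

text \<open>
  Such a list is determined by the positions of its nonzero entries. Splitting on whether the
  first entry is zero gives the recursion of Pascal's triangle. Finiteness is carried along
  because the cardinality of the union needs it.
\<close>

lemma card_lists_filter_eq:
  assumes "0 \<notin> set ps"
  shows "finite {cs :: nat list. length cs = N \<and> filter (\<lambda>c. c \<noteq> 0) cs = ps}
    \<and> card {cs :: nat list. length cs = N \<and> filter (\<lambda>c. c \<noteq> 0) cs = ps} = N choose length ps"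
  using assms
proof (induction N arbitrary: ps)
  case 0
  have "{cs :: nat list. length cs = 0 \<and> filter (\<lambda>c. c \<noteq> 0) cs = ps}
      = (if ps = [] then {[]} else {})" by auto
  then show ?case by (cases ps) auto
next
  case (Suc N)
  let ?F = "\<lambda>N ps. {cs :: nat list. length cs = N \<and> filter (\<lambda>c. c \<noteq> 0) cs = ps}"
  show ?case
  proof (cases ps)
    case Nil
    have "?F (Suc N) ps = Cons 0 ` ?F N []"
      using Nil by (auto simp: length_Suc_conv image_iff split: if_splits)
    then show ?thesis using Suc.IH[of "[]"] Nil by (simp add: card_image)
  next
    case (Cons p qs)
    have "?F (Suc N) ps = Cons 0 ` ?F N ps \<union> Cons p ` ?F N qs"
      using Cons Suc.prems by (auto simp: length_Suc_conv image_iff split: if_splits)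
    moreover have "Cons 0 ` ?F N ps \<inter> Cons p ` ?F N qs = {}"
      using Cons Suc.prems by auto
    ultimately show ?thesis
      using Suc.IH[of ps] Suc.IH[of qs] Cons Suc.prems
      by (simp add: card_Un_disjoint card_image)
  qed
qed

lemma card_compositions:
  assumes "1 \<le> k" "k \<le> s"
  shows "card {ps :: nat list. 0 \<notin> set ps \<and> length ps = k \<and> sum_list ps = s} = (s - 1) choose (k - 1)"
proof -
  let ?A = "{ps :: nat list. length ps = k \<and> sum_list ps = s - k}"
  have sum_Suc: "sum_list (map Suc ps) = sum_list ps + length ps" for ps
    by (induction ps) auto
  have "{ps. 0 \<notin> set ps \<and> length ps = k \<and> sum_list ps = s} = map Suc ` ?A" (is "?B = _")
  proof
    show "?B \<subseteq> map Suc ` ?A"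
    proof
      fix ps assume ps: "ps \<in> ?B"
      have "Suc (p - 1) = p" if "p \<in> set ps" for p
        using ps that by (cases p) auto
      then have eq: "ps = map Suc (map (\<lambda>p. p - 1) ps)"
        by (simp add: map_idI)
      moreover have "map (\<lambda>p. p - 1) ps \<in> ?A"
        using ps sum_Suc[of "map (\<lambda>p. p - 1) ps"] arg_cong[OF eq, of sum_list] by simp
      ultimately show "ps \<in> map Suc ` ?A" by blast
    qed
    show "map Suc ` ?A \<subseteq> ?B" using assms by (auto simp: sum_Suc)
  qed
  then have "card ?B = card ?A"
    using card_image[OF inj_on_subset[OF inj_mapI[OF inj_Suc] subset_UNIV], of ?A] by simp
  also have "\<dots> = (s - 1) choose (s - k)"
    using card_length_sum_list[of k "s - k"] assms by simp
  also have "\<dots> = (s - 1) choose (k - 1)"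
    using binomial_symmetric[of "k - 1" "s - 1"] assms by simp
  finally show ?thesis .
qed

lemma card_sparse_lists:
  assumes "1 \<le> k" "k \<le> s"
  shows "card (sparse_lists N s k) = (N choose k) * ((s - 1) choose (k - 1))"
proof -
  let ?B = "{ps :: nat list. 0 \<notin> set ps \<and> length ps = k \<and> sum_list ps = s}"
  let ?F = "\<lambda>ps. {cs :: nat list. length cs = N \<and> filter (\<lambda>c. c \<noteq> 0) cs = ps}"
  have sum_filter: "sum_list (filter (\<lambda>c. c \<noteq> 0) cs) = sum_list cs" for cs :: "nat list"
    by (induction cs) auto
  have "sparse_lists N s k = (\<Union>ps\<in>?B. ?F ps)"
    by (auto simp: sparse_lists_def sum_filter simp del: neq0_conv)
  moreover have "finite ?B"
    by (rule finite_subset[OF _ finite_lists_sum_nat[of k s]]) auto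
  ultimately have "card (sparse_lists N s k) = (\<Sum>ps\<in>?B. card (?F ps))"
    using card_lists_filter_eq[of _ N] by (simp only:) (rule card_UN_disjoint, auto)
  also have "\<dots> = (\<Sum>ps\<in>?B. N choose k)"
    using card_lists_filter_eq[of _ N] by (intro sum.cong) auto
  finally show ?thesis using card_compositions[OF assms] by simp
qed

section \<open>The count of paths\<close>

lemma num_dyck_paths_ends_UU:
  assumes "1 \<le> m" "m \<le> N" "1 \<le> k" "k \<le> N"
  shows "N * num_dyck_paths_ends U U (Suc N) m k = (N choose k) * (N choose (k - 1))"
proof -
  have "num_dyck_paths_ends U U (Suc N) m k
      = card {cs \<in> sparse_lists N (Suc N) k. positive_partial_sums cs = m}"
    unfolding num_dyck_paths_ends_def dyck_paths_ends_UU
    by (rule card_image) (rule inj_on_subset[OF inj_up_path], simp)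
  then show ?thesis
    using card_sparse_lists_equidistributed[of m N k] card_sparse_lists[of k "Suc N" N] assms
    by simp
qed

theorem corollary6:
  fixes n m k :: nat
  assumes "n > 0" and "1 \<le> m" and "m \<le> n - 1" and "1 \<le> k" and "k \<le> n - 1"
  shows "num_dyck_paths_ends U U n m k = num_dyck_paths_ends D D n m k
    \<and> real (num_dyck_paths_ends D D n m k)
        = 1 / (real n - 1) * real ((n - 1) choose k) * real ((n - 1) choose (k - 1))"
proof -
  have eq: "num_dyck_paths_ends D D n m k = num_dyck_paths_ends U U n m k"
    using num_dyck_paths_ends_flip[of U U n m k] by simp
  obtain N where n: "n = Suc N" using assms(1) by (cases n) auto
  with assms have "N > 0" by simp
  have "N * num_dyck_paths_ends U U n m k = (N choose k) * (N choose (k - 1))"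
    using num_dyck_paths_ends_UU[of m N k] assms n by simp
  then have "real N * real (num_dyck_paths_ends U U n m k)
      = real (N choose k) * real (N choose (k - 1))"
    by (metis of_nat_mult)
  with \<open>N > 0\<close> n eq show ?thesis
    by (simp add: field_simps)
qed

end
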